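(* Let $\Omega\subset\mathbb{C}^n$ be a bounded domain, let $1<p<\infty$, and let $q$ be the conjugate exponent of $p$. Suppose there exist a bounded linear operator $\mathbf{P}:L^2(\Omega)\to A^2(\Omega)$ given by an integral formula $\mathbf{P}f(z)=\int_\Omega P(z,w)f(w)\,dV(w)$ and a linear subspace $\mathcal{G}\subseteq A^p(\Omega)$ such that (i) $|\mathbf{P}|$ is bounded on $L^p(\Omega)$; (ii) $\mathbf{P}F=F$ for all $F\in\mathcal{G}$; (iii) the range of $\mathbf{P}^\dagger$ is contained in $A^q(\Omega)$, i.e. $\mathbf{P}^\dagger g\in A^q(\Omega)$ for all $g\in L^q(\Omega)$. Then the map $\Phi_p:A^q(\Omega)\to\mathcal{G}'$, $\Phi_p(g)(F)=\int_\Omega F\,\overline{g}\,dV$ for $F\in\mathcal{G}$, is surjective.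
   Context: $dV$ is Lebesgue measure; $A^p(\Omega)$ is the Bergman space of holomorphic functions on $\Omega$ lying in $L^p(\Omega)$, with the $L^p$ norm. $\mathcal{G}$ carries the $L^p$ norm and $\mathcal{G}'$ is its space of bounded linear functionals. For an operator $\mathbf{P}$ with kernel $P(z,w)$, $|\mathbf{P}|f(z)=\int_\Omega|P(z,w)|f(w)\,dV(w)$ and $\mathbf{P}^\dagger f(w)=\int_\Omega\overline{P(z,w)}f(z)\,dV(z)$; these operators and $\mathbf{P}$ are defined on $L^p$ or $L^q$ functions by the integrals whenever these converge (almost everywhere). *)

theory Defs
  imports "HOL-Analysis.Analysis"
begin

definition Lp_space :: "(complex ^ 'n) set \<Rightarrow> real \<Rightarrow> (complex ^ 'n \<Rightarrow> complex) set" where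
  "Lp_space \<Omega> p = {f. f \<in> borel_measurable (lebesgue_on \<Omega>) \<and>
     integrable (lebesgue_on \<Omega>) (\<lambda>z. cmod (f z) powr p)}"

definition Lp_norm :: "(complex ^ 'n) set \<Rightarrow> real \<Rightarrow> (complex ^ 'n \<Rightarrow> complex) \<Rightarrow> real" where
  "Lp_norm \<Omega> p f = (LINT z|lebesgue_on \<Omega>. cmod (f z) powr p) powr (1 / p)"

text \<open>Functions on \<open>\<Omega>\<close> are total functions whose values outside \<open>\<Omega>\<close> are irrelevant, and they are
  not quotiented by almost everywhere equality. Wherever the mathematics speaks of elements of
  \<open>L\<^sup>p\<close>, equality is therefore stated almost everywhere on \<open>\<Omega>\<close>.\<close>

definition several_holomorphic_on :: "(complex ^ 'n \<Rightarrow> complex) \<Rightarrow> (complex ^ 'n) set \<Rightarrow> bool" where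
  "several_holomorphic_on f S \<longleftrightarrow>
     (\<forall>z\<in>S. \<exists>f'. (f has_derivative f') (at z within S) \<and> (\<forall>c v. f' (c *s v) = c * f' v))"

definition bergman_space :: "(complex ^ 'n) set \<Rightarrow> real \<Rightarrow> (complex ^ 'n \<Rightarrow> complex) set" where
  "bergman_space \<Omega> p = {f \<in> Lp_space \<Omega> p. several_holomorphic_on f \<Omega>}"

definition function_subspace :: "('a \<Rightarrow> complex) set \<Rightarrow> bool" where
  "function_subspace G \<longleftrightarrow> (\<lambda>z. 0) \<in> G \<and>
     (\<forall>F\<in>G. \<forall>H\<in>G. (\<lambda>z. F z + H z) \<in> G) \<and> (\<forall>c. \<forall>F\<in>G. (\<lambda>z. c * F z) \<in> G)"

text \<open>\<open>kernel_maps \<Omega> K f h\<close>: for almost every \<open>z\<close> in \<open>\<Omega>\<close> the integral of \<open>K z w * f w\<close> over \<open>w\<close>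
  in \<open>\<Omega>\<close> converges absolutely, with value \<open>h z\<close>. So \<open>h\<close> represents the image of \<open>f\<close> under the
  operator with kernel \<open>K\<close>; linearity of the operator is that of the integral.\<close>

definition kernel_maps ::
    "(complex ^ 'n) set \<Rightarrow> (complex ^ 'n \<Rightarrow> complex ^ 'n \<Rightarrow> complex) \<Rightarrow>
     (complex ^ 'n \<Rightarrow> complex) \<Rightarrow> (complex ^ 'n \<Rightarrow> complex) \<Rightarrow> bool" where
  "kernel_maps \<Omega> K f h \<longleftrightarrow>
     (AE z in lebesgue_on \<Omega>. has_bochner_integral (lebesgue_on \<Omega>) (\<lambda>w. K z w * f w) (h z))"

definition kernel_bounded ::
    "(complex ^ 'n) set \<Rightarrow> real \<Rightarrow> (complex ^ 'n \<Rightarrow> complex ^ 'n \<Rightarrow> complex) \<Rightarrow>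
     (complex ^ 'n \<Rightarrow> complex) set \<Rightarrow> (complex ^ 'n \<Rightarrow> complex) set \<Rightarrow> bool" where
  "kernel_bounded \<Omega> p K X Y \<longleftrightarrow>
     (\<exists>C. \<forall>f\<in>X. \<exists>h\<in>Y. kernel_maps \<Omega> K f h \<and> Lp_norm \<Omega> p h \<le> C * Lp_norm \<Omega> p f)"

definition abs_kernel ::
    "(complex ^ 'n \<Rightarrow> complex ^ 'n \<Rightarrow> complex) \<Rightarrow> complex ^ 'n \<Rightarrow> complex ^ 'n \<Rightarrow> complex" where
  "abs_kernel P z w = complex_of_real (cmod (P z w))"

definition adjoint_kernel ::
    "(complex ^ 'n \<Rightarrow> complex ^ 'n \<Rightarrow> complex) \<Rightarrow> complex ^ 'n \<Rightarrow> complex ^ 'n \<Rightarrow> complex" where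
  "adjoint_kernel P w z = cnj (P z w)"

text \<open>Functionals on \<open>G\<close> are \<^const>\<open>extensional\<close>, so that equality of functionals is equality
  on \<open>G\<close>.\<close>

definition dual_space ::
    "(complex ^ 'n) set \<Rightarrow> real \<Rightarrow> (complex ^ 'n \<Rightarrow> complex) set \<Rightarrow>
     ((complex ^ 'n \<Rightarrow> complex) \<Rightarrow> complex) set" where
  "dual_space \<Omega> p G = {\<phi> \<in> extensional G.
     (\<forall>F\<in>G. \<forall>H\<in>G. \<phi> (\<lambda>z. F z + H z) = \<phi> F + \<phi> H) \<and>
     (\<forall>c. \<forall>F\<in>G. \<phi> (\<lambda>z. c * F z) = c * \<phi> F) \<and>
     (\<exists>C. \<forall>F\<in>G. cmod (\<phi> F) \<le> C * Lp_norm \<Omega> p F)}"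

definition pairing_map ::
    "(complex ^ 'n) set \<Rightarrow> (complex ^ 'n \<Rightarrow> complex) set \<Rightarrow> (complex ^ 'n \<Rightarrow> complex) \<Rightarrow>
     (complex ^ 'n \<Rightarrow> complex) \<Rightarrow> complex" where
  "pairing_map \<Omega> G g = (\<lambda>F\<in>G. LINT z|lebesgue_on \<Omega>. F z * cnj (g z))"

end

theory Submission
  imports Defs
begin

text \<open>A bounded functional \<open>\<phi> \<noteq> 0\<close> on \<open>G\<close> is represented by some \<open>g \<in> L\<^sup>q\<close>; this replaces Hahn-Banach
  and Riesz representation by a minimisation. By uniform convexity a minimising sequence for
  \<open>\<integral>|F|\<^sup>p\<close> over \<open>{F \<in> G. \<phi> F = 1}\<close> is Cauchy in \<open>L\<^sup>p\<close>. If \<open>f\<close> is its limit and \<open>d = \<integral>|f|\<^sup>p\<close>, the first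
  variation shows that \<open>F \<mapsto> \<integral> F |f|\<^sup>p\<^sup>-\<^sup>2 cnj f\<close> vanishes on the kernel of \<open>\<phi>\<close>, so
  \<open>g = |f|\<^sup>p\<^sup>-\<^sup>2 f / d\<close> works. Then \<open>h = P\<^sup>\<dagger> g\<close> lies in \<open>A\<^sup>q\<close> and
  \<open>\<integral> F cnj h = \<integral> (P F) cnj g = \<integral> F cnj g = \<phi> F\<close>, where boundedness of \<open>|P|\<close> on \<open>L\<^sup>p\<close> together with
  Hoelder's inequality justifies the use of Fubini's theorem.\<close>

subsection \<open>Uniform convexity of the p-th power of the modulus\<close>

text \<open>A strict Bernoulli inequality. The derivative of \<open>f\<close> is negative on (0,1)
  and positive beyond 1, so 1 is the strict minimum of \<open>f\<close> among positive arguments.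
  The point 0 is checked directly, since the derivative formula is used only at positive
  \<open>y\<close>.\<close>

lemma powr_gt_tangent_at_1:
  fixes p x :: real
  assumes "1 < p" "0 \<le> x" "x \<noteq> 1"
  shows "1 + p * (x - 1) < x powr p"
proof (cases "x = 0")
  case True
  then show ?thesis using assms by simp
next
  case False
  then have x: "0 < x" using assms by simp
  define f where "f y = y powr p - p * y" for y :: real
  have der: "(f has_real_derivative p * (y powr (p - 1) - 1)) (at y)" if "0 < y" for y
    unfolding f_def using that by (auto intro!: derivative_eq_intros simp: algebra_simps)
  have "f 1 < f x"
  proof (cases "x < 1")
    case True
    have "f x > f 1"
    proof (rule DERIV_neg_imp_decreasing_open[OF True])
      fix y assume "x < y" "y < 1"
      then show "\<exists>z. DERIV f y :> z \<and> z < 0"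
        using der[of y] x assms powr_less_mono2[of "p - 1" y 1]
        by (intro exI[of _ "p * (y powr (p - 1) - 1)"]) (auto simp: mult_less_0_iff)
    next
      show "continuous_on {x..1} f"
        using der x by (intro continuous_at_imp_continuous_on) (meson DERIV_isCont atLeastAtMost_iff less_le_trans zero_less_one)
    qed
    then show ?thesis .
  next
    case False
    then have "1 < x" using assms by simp
    then show ?thesis
    proof (rule DERIV_pos_imp_increasing_open)
      fix y :: real assume "1 < y" "y < x"
      then show "\<exists>z. DERIV f y :> z \<and> z > 0"
        using der[of y] x assms powr_less_mono2[of "p - 1" 1 y]
        by (intro exI[of _ "p * (y powr (p - 1) - 1)"]) auto
    next
      show "continuous_on {1..x} f"
        using der x by (intro continuous_at_imp_continuous_on) (meson DERIV_isCont atLeastAtMost_iff less_le_trans zero_less_one)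
    qed
  qed
  then show ?thesis by (simp add: f_def algebra_simps)
qed

text \<open>The real gradient of \<open>|a|\<^sup>p / p\<close>, i.e. \<open>|a|\<^sup>p\<^sup>-\<^sup>2 a\<close> in a form that is also correct at
  \<open>a = 0\<close> when \<open>p < 2\<close>.\<close>

definition powr_gradient :: "real \<Rightarrow> complex \<Rightarrow> complex" where
  "powr_gradient p a = complex_of_real (cmod a powr (p - 1)) * sgn a"

lemma cmod_powr_gradient: "cmod (powr_gradient p a) = cmod a powr (p - 1)"
  by (cases "a = 0") (simp_all add: powr_gradient_def norm_mult norm_sgn)

lemma powr_gradient_mult_cnj: "1 < p \<Longrightarrow> a * cnj (powr_gradient p a) = complex_of_real (cmod a powr p)"
proof (cases "a = 0")
  case False
  assume "1 < p"
  have "a * cnj (powr_gradient p a) = complex_of_real (cmod a powr (p - 1)) * (a * cnj a / cmod a)"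
    by (simp add: powr_gradient_def sgn_eq)
  also have "a * cnj a / cmod a = complex_of_real (cmod a)"
    using False by (simp add: complex_norm_square[symmetric] power2_eq_square)
  also have "complex_of_real (cmod a powr (p - 1)) * complex_of_real (cmod a) = complex_of_real (cmod a powr p)"
    using False by (simp add: powr_diff)
  finally show ?thesis .
qed (simp add: powr_gradient_def)

text \<open>Strict convexity of the p-th power of the modulus on the real plane, whose gradient at
  \<open>a\<close> is p times \<open>powr_gradient p a\<close>. Strictness has two sources: if the
  moduli differ, the Bernoulli inequality for the ratio \<open>cmod b / cmod a\<close>; if they
  agree, the component \<open>?c\<close> of \<open>b\<close> in the direction of \<open>a\<close> is
  strictly smaller than \<open>cmod b\<close>. At \<open>a = 0\<close> the gradient
  vanishes.\<close>

lemma cmod_powr_gt_tangent: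
  assumes "1 < p" "a \<noteq> b"
  shows "cmod a powr p + p * Re ((b - a) * cnj (powr_gradient p a)) < cmod b powr p"
proof (cases "a = 0")
  case True
  then show ?thesis using assms by (simp add: powr_gradient_def)
next
  case False
  let ?r = "cmod a" and ?c = "Re (b * cnj (sgn a))"
  have r: "0 < ?r" using False by simp
  have "Re (b * cnj (powr_gradient p a)) = ?r powr (p - 1) * ?c"
    by (simp add: powr_gradient_def algebra_simps)
  then have lhs: "?r powr p + p * Re ((b - a) * cnj (powr_gradient p a))
      = ?r powr p + p * (?r powr (p - 1) * ?c - ?r powr p)"
    using powr_gradient_mult_cnj[OF assms(1), of a] by (simp add: left_diff_distrib)
  have c: "?c \<le> cmod b"
    using complex_Re_le_cmod[of "b * cnj (sgn a)"] False by (simp add: norm_mult norm_sgn)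
  have rp: "?r powr p = ?r powr (p - 1) * ?r"
    using r by (simp add: powr_diff)
  show ?thesis
  proof (cases "cmod b = cmod a")
    case True
    \<comment> \<open>Equality case of Re z \<le> |z|: it forces \<open>b * cnj (sgn a)\<close> to
      be the real number \<open>?r\<close>, and multiplying by \<open>sgn a\<close>, of modulus 1,
      gives \<open>b = a\<close>.\<close>
    have "?c \<noteq> ?r"
    proof
      assume eq: "?c = ?r"
      have n: "cmod (b * cnj (sgn a)) = ?r"
        using True False by (simp add: norm_mult norm_sgn)
      then have "Im (b * cnj (sgn a)) = 0"
        using eq cmod_power2[of "b * cnj (sgn a)"] by (metis add_cancel_right_right power_eq_0_iff)
      then have "b * cnj (sgn a) = ?r"
        using eq by (simp add: complex_eq_iff)
      then have "b * (cnj (sgn a) * sgn a) = ?r * sgn a"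
        by (simp add: mult.assoc)
      moreover have "cnj (sgn a) * sgn a = 1"
        using False complex_norm_square[of "sgn a"] by (simp add: norm_sgn mult.commute)
      ultimately have "b = a"
        using False by (simp add: sgn_eq)
      then show False using assms by simp
    qed
    then have "?c < ?r" using c True by simp
    then have "?r powr (p - 1) * ?c < ?r powr p"
      using r by (simp add: rp)
    then show ?thesis
      using lhs True assms(1) by (simp add: mult_pos_neg)
  next
    case neq: False
    have "1 + p * (cmod b / ?r - 1) < (cmod b / ?r) powr p"
      using neq r by (intro powr_gt_tangent_at_1[OF assms(1)]) auto
    then have "?r powr p * (1 + p * (cmod b / ?r - 1)) < ?r powr p * (cmod b / ?r) powr p"
      using r by simp
    also have "\<dots> = cmod b powr p"
      using r by (simp add: powr_divide)
    finally have "?r powr p + p * (?r powr (p - 1) * cmod b - ?r powr p) < cmod b powr p"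
      using r by (simp add: rp field_simps)
    moreover have "p * (?r powr (p - 1) * ?c) \<le> p * (?r powr (p - 1) * cmod b)"
      using c assms(1) by (intro mult_left_mono) auto
    ultimately show ?thesis
      unfolding lhs by (simp add: right_diff_distrib)
  qed
qed

lemma cmod_powr_ge_tangent:
  assumes "1 < p"
  shows "cmod a powr p + p * Re ((b - a) * cnj (powr_gradient p a)) \<le> cmod b powr p"
  using cmod_powr_gt_tangent[OF assms, of a b] by (cases "a = b") auto

text \<open>Add the two tangent inequalities based at the midpoint. The displacements to
  \<open>a\<close> and \<open>b\<close> are opposite, so the linear terms cancel.\<close>

lemma cmod_powr_midpoint_less:
  assumes "1 < p" "a \<noteq> b"
  shows "cmod ((a + b) / 2) powr p < (cmod a powr p + cmod b powr p) / 2"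
proof -
  let ?m = "(a + b) / 2"
  have "?m \<noteq> a" "?m \<noteq> b"
    using assms(2) by (auto simp: field_simps)
  then have "cmod ?m powr p + p * Re ((a - ?m) * cnj (powr_gradient p ?m))
      + (cmod ?m powr p + p * Re ((b - ?m) * cnj (powr_gradient p ?m))) < cmod a powr p + cmod b powr p"
    by (intro add_strict_mono cmod_powr_gt_tangent[OF assms(1)])
  moreover have "b - ?m = - (a - ?m)" by (simp add: field_simps)
  then have "Re ((b - ?m) * cnj (powr_gradient p ?m)) = - Re ((a - ?m) * cnj (powr_gradient p ?m))"
    by (simp only: mult_minus_left uminus_complex.sel)
  ultimately show ?thesis by (simp del: times_complex.sel)
qed

lemma cmod_powr_midpoint_le:
  assumes "1 < p"
  shows "cmod ((a + b) / 2) powr p \<le> (cmod a powr p + cmod b powr p) / 2"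
  using cmod_powr_midpoint_less[OF assms, of a b] by (cases "a = b") auto

text \<open>Midpoint convexity with the factor 1/2 given away; this crude constant suffices for
  closure under sums and for dominating functions.\<close>

lemma cmod_add_powr_le:
  assumes "1 < p"
  shows "cmod (a + b) powr p \<le> 2 powr p * (cmod a powr p + cmod b powr p)"
proof -
  have "cmod (a + b) powr p = 2 powr p * cmod ((a + b) / 2) powr p"
    by (simp add: norm_divide powr_divide)
  also have "\<dots> \<le> 2 powr p * ((cmod a powr p + cmod b powr p) / 2)"
    by (intro mult_left_mono cmod_powr_midpoint_le assms) simp
  also have "\<dots> \<le> 2 powr p * (cmod a powr p + cmod b powr p)"
    by (intro mult_left_mono) auto
  finally show ?thesis .
qed

lemma cmod_powr_uniformly_convex:
  assumes "1 < p" "0 < e"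
  obtains K where "0 \<le> K"
    "\<And>a b. cmod (a - b) powr p \<le> e * (cmod a powr p + cmod b powr p)
        + K * ((cmod a powr p + cmod b powr p) / 2 - cmod ((a + b) / 2) powr p)"
proof -
  \<comment> \<open>By homogeneity it suffices to consider \<open>|a|\<^sup>p + |b|\<^sup>p = 1\<close>. On the compact set where moreover
    \<open>|a - b|\<^sup>p \<ge> e\<close> the convexity defect \<open>D\<close> is continuous and positive, hence bounded below.\<close>
  define s where "s x = cmod (fst x) powr p + cmod (snd x) powr p" for x :: "complex \<times> complex"
  define d where "d x = cmod (fst x - snd x) powr p" for x :: "complex \<times> complex"
  define D where "D x = s x / 2 - cmod ((fst x + snd x) / 2) powr p" for x :: "complex \<times> complex"
  define S where "S = {x. s x = 1 \<and> e \<le> d x}"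
  have cont: "continuous_on T s" "continuous_on T d" "continuous_on T D" for T
    unfolding D_def s_def d_def
    using assms by (auto intro!: continuous_intros continuous_on_powr')
  have "closed S"
    unfolding S_def using cont[of UNIV]
    by (intro closed_Collect_conj closed_Collect_eq closed_Collect_le) auto
  moreover have "bounded S"
  proof -
    have "x \<in> cball 0 1 \<times> cball 0 1" if "x \<in> S" for x
    proof -
      have "s x = 1" using that by (simp add: S_def)
      then have "cmod (fst x) powr p \<le> 1" "cmod (snd x) powr p \<le> 1"
        using powr_ge_zero[of "cmod (fst x)" p] powr_ge_zero[of "cmod (snd x)" p]
        unfolding s_def by linarith+
      then have "cmod (fst x) \<le> 1" "cmod (snd x) \<le> 1"
        using assms powr_less_mono2[of p 1 "cmod (fst x)"] powr_less_mono2[of p 1 "cmod (snd x)"]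
        by (force simp: not_le[symmetric])+
      then show ?thesis by (simp add: mem_Times_iff)
    qed
    then show ?thesis
      by (intro bounded_subset[OF bounded_Times[OF bounded_cball bounded_cball]] subsetI)
  qed
  ultimately have "compact S" by (simp add: compact_eq_bounded_closed)
  have Dpos: "0 < D x" if "x \<in> S" for x
  proof -
    have "fst x \<noteq> snd x" using that assms by (auto simp: S_def d_def)
    then show ?thesis
      using cmod_powr_midpoint_less[OF assms(1)] by (simp add: D_def s_def)
  qed
  have "compact ((\<lambda>x. d x / D x) ` S)"
    by (intro compact_continuous_image \<open>compact S\<close> continuous_on_divide cont) (auto dest: Dpos)
  then obtain K where K: "0 < K" "\<And>x. x \<in> S \<Longrightarrow> \<bar>d x / D x\<bar> \<le> K"
    by (auto dest!: compact_imp_bounded simp: bounded_pos)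
  have Dnn: "0 \<le> D x" for x
    using cmod_powr_midpoint_le[OF assms(1)] by (simp add: D_def s_def)
  have unit: "d x \<le> e * s x + K * D x" if "s x = 1" for x
  proof (cases "x \<in> S")
    case True
    then have "d x \<le> K * D x"
      using K(2)[OF True] Dpos[OF True] by (simp add: abs_le_iff pos_divide_le_eq)
    then show ?thesis using assms that by simp
  next
    case False
    then have "d x < e" using that by (simp add: S_def)
    moreover have "0 \<le> K * D x" using Dnn[of x] K(1) by simp
    ultimately show ?thesis using that by simp
  qed
  have all: "d x \<le> e * s x + K * D x" for x
  proof (cases "s x = 0")
    case True
    then have "cmod (fst x) powr p = 0" "cmod (snd x) powr p = 0"
      using powr_ge_zero[of "cmod (fst x)" p] powr_ge_zero[of "cmod (snd x)" p]
      unfolding s_def by linarith+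
    then show ?thesis using True Dnn[of x] K(1) by (simp add: d_def)
  next
    case False
    then have pos: "0 < s x" by (simp add: s_def less_le)
    \<comment> \<open>The scaling with \<open>r powr p = 1 / s x\<close>: it divides each of
      \<open>s\<close>, \<open>d\<close> and \<open>D\<close> by \<open>s x\<close> and thus
      normalises \<open>s\<close> to 1.\<close>
    define r where "r = 1 / s x powr (1 / p)"
    have r: "0 < r" "r powr p = 1 / s x"
      using pos assms by (auto simp: r_def powr_divide powr_powr)
    have sc: "cmod (r *\<^sub>R z) powr p = cmod z powr p / s x" for z :: complex
      using r by (simp add: powr_mult)
    have "s (r *\<^sub>R x) = s x / s x"
      unfolding s_def[of "r *\<^sub>R x"] fst_scaleR snd_scaleR sc add_divide_distrib[symmetric]
      by (simp add: s_def)
    moreover have "d (r *\<^sub>R x) = d x / s x"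
      unfolding d_def using sc[of "fst x - snd x"] by (simp add: scaleR_diff_right)
    moreover have "D (r *\<^sub>R x) = s (r *\<^sub>R x) / 2 - cmod ((fst x + snd x) / 2) powr p / s x"
    proof -
      have "(fst (r *\<^sub>R x) + snd (r *\<^sub>R x)) / 2 = r *\<^sub>R ((fst x + snd x) / 2)"
        by (simp add: scaleR_conv_of_real field_simps)
      then show ?thesis unfolding D_def by (simp only: sc)
    qed
    ultimately have "d x / s x \<le> e + K * (1 / 2 - cmod ((fst x + snd x) / 2) powr p / s x)"
      using unit[of "r *\<^sub>R x"] pos by simp
    then have "d x \<le> (e + K * (1 / 2 - cmod ((fst x + snd x) / 2) powr p / s x)) * s x"
      using pos by (simp add: pos_divide_le_eq)
    also have "\<dots> = e * s x + K * D x"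
      using pos by (simp add: D_def algebra_simps)
    finally show ?thesis .
  qed
  show ?thesis
  proof (rule that[of K])
    show "0 \<le> K" using K(1) by simp
    show "cmod (a - b) powr p \<le> e * (cmod a powr p + cmod b powr p)
        + K * ((cmod a powr p + cmod b powr p) / 2 - cmod ((a + b) / 2) powr p)" for a b
      using all[of "(a, b)"] by (simp add: s_def d_def D_def)
  qed
qed

text \<open>Only the origin is delicate, since \<open>sgn\<close> jumps there; the factor
  \<open>cmod a powr (p - 1)\<close> tends to 0 because p exceeds 1 and removes the jump.\<close>

lemma isCont_powr_gradient:
  assumes "1 < p"
  shows "isCont (powr_gradient p) a"
proof (cases "a = 0")
  case True
  have "((\<lambda>z. cmod z powr (p - 1)) \<longlongrightarrow> cmod 0 powr (p - 1)) (at 0)"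
    using assms by (intro tendsto_powr' tendsto_norm tendsto_ident_at tendsto_const) auto
  then have "((\<lambda>z. cmod (powr_gradient p z)) \<longlongrightarrow> 0) (at 0)"
    by (simp add: cmod_powr_gradient)
  then show ?thesis
    using True tendsto_norm_zero_cancel[of "powr_gradient p" "at 0"]
    by (simp add: isCont_def powr_gradient_def[of p 0])
next
  case False
  then show ?thesis
    unfolding powr_gradient_def by (auto intro!: continuous_intros)
qed

lemma powr_gradient_measurable [measurable]:
  assumes "1 < p"
  shows "powr_gradient p \<in> borel_measurable borel"
  using isCont_powr_gradient[OF assms]
  by (intro borel_measurable_continuous_onI continuous_at_imp_continuous_on) auto

subsection \<open>Functions with integrable p-th power\<close>

lemma borel_measurable_cnj [measurable (raw)]:
  "f \<in> borel_measurable M \<Longrightarrow> (\<lambda>x. cnj (f x)) \<in> borel_measurable M"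
  using measurable_compose[of f M borel cnj borel]
    borel_measurable_continuous_onI[OF linear_continuous_on[OF bounded_linear_cnj]] by blast

text \<open>The condition of \<open>Lp_space\<close> over an arbitrary measure, so that the
  representation of functionals does not refer to a domain.\<close>

definition Lp_fun :: "'a measure \<Rightarrow> real \<Rightarrow> ('a \<Rightarrow> complex) \<Rightarrow> bool" where
  "Lp_fun M p f \<longleftrightarrow> f \<in> borel_measurable M \<and> integrable M (\<lambda>x. cmod (f x) powr p)"

lemma Lp_fun_measurable: "Lp_fun M p f \<Longrightarrow> f \<in> borel_measurable M"
  by (simp add: Lp_fun_def)

lemma Lp_fun_integrable: "Lp_fun M p f \<Longrightarrow> integrable M (\<lambda>x. cmod (f x) powr p)"
  by (simp add: Lp_fun_def)

lemma Lp_fun_bound: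
  assumes "f \<in> borel_measurable M" "integrable M w" "AE x in M. cmod (f x) powr p \<le> w x"
  shows "Lp_fun M p f"
  unfolding Lp_fun_def
proof
  note [measurable] = assms(1)
  show "integrable M (\<lambda>x. cmod (f x) powr p)"
    by (rule Bochner_Integration.integrable_bound[OF assms(2)]) (use assms(3) in \<open>auto elim: eventually_mono\<close>)
qed (fact assms(1))

lemma Lp_fun_add:
  assumes "1 < p" "Lp_fun M p f" "Lp_fun M p g"
  shows "Lp_fun M p (\<lambda>x. f x + g x)"
proof (rule Lp_fun_bound)
  show "integrable M (\<lambda>x. 2 powr p * (cmod (f x) powr p + cmod (g x) powr p))"
    using assms by (simp add: Lp_fun_def)
  show "AE x in M. cmod (f x + g x) powr p \<le> 2 powr p * (cmod (f x) powr p + cmod (g x) powr p)"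
    using cmod_add_powr_le[OF assms(1)] by simp
qed (use assms in \<open>auto simp: Lp_fun_def\<close>)

lemma Lp_fun_cmult: "Lp_fun M p f \<Longrightarrow> Lp_fun M p (\<lambda>x. c * f x)"
  by (auto simp: Lp_fun_def norm_mult powr_mult)

lemma Lp_fun_diff:
  assumes "1 < p" "Lp_fun M p f" "Lp_fun M p g"
  shows "Lp_fun M p (\<lambda>x. f x - g x)"
  using Lp_fun_add[OF assms(1,2) Lp_fun_cmult[OF assms(3), of "-1"]] by simp

lemma conjugate_exponent_gt_1:
  fixes p q :: real
  assumes "1 < p" "1 / p + 1 / q = 1"
  shows "1 < q" "q = p / (p - 1)"
proof -
  have "q \<noteq> 0" using assms by auto
  then show q: "q = p / (p - 1)" using assms by (simp add: field_simps)
  show "1 < q" unfolding q using assms by simp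
qed

text \<open>Young's inequality supplies the integrable majorant.\<close>

lemma Lp_fun_mult_integrable:
  assumes "1 < p" "1 / p + 1 / q = 1" "Lp_fun M p f" "Lp_fun M q g"
  shows "integrable M (\<lambda>x. f x * g x)"
proof (rule Bochner_Integration.integrable_bound)
  show "integrable M (\<lambda>x. cmod (f x) powr p / p + cmod (g x) powr q / q)"
    using assms by (auto simp: Lp_fun_def)
  show "AE x in M. norm (f x * g x) \<le> norm (cmod (f x) powr p / p + cmod (g x) powr q / q)"
    using Youngs_inequality[OF assms(1) conjugate_exponent_gt_1(1)[OF assms(1,2)] assms(2)] assms
      conjugate_exponent_gt_1(1)[OF assms(1,2)]
    by (simp add: norm_mult)
qed (use assms in \<open>auto simp: Lp_fun_def\<close>)

lemma Holder_bound:
  assumes "1 < p" "1 / p + 1 / q = 1" "Lp_fun M q g"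
  shows "\<exists>C. \<forall>f. Lp_fun M p f \<longrightarrow>
    cmod (LINT x|M. f x * g x) \<le> C * (LINT x|M. cmod (f x) powr p) powr (1 / p)"
proof (intro exI allI impI)
  \<comment> \<open>Young's inequality after normalising \<open>f\<close>; the resulting constant is not the optimal one.\<close>
  define C where "C = 1 / p + (LINT x|M. cmod (g x) powr q) / q"
  fix f assume f: "Lp_fun M p f"
  define s where "s = (LINT x|M. cmod (f x) powr p) powr (1 / p)"
  have q: "1 < q" using conjugate_exponent_gt_1[OF assms(1,2)] by simp
  show "cmod (LINT x|M. f x * g x) \<le> C * s"
  proof (cases "s = 0")
    case True
    then have "AE x in M. cmod (f x) powr p = 0"
      using Lp_fun_integrable[OF f] by (simp add: s_def integral_nonneg_eq_0_iff_AE)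
    then have "(LINT x|M. f x * g x) = 0"
      by (intro integral_eq_zero_AE) (auto elim: eventually_mono)
    then show ?thesis using True by simp
  next
    case False
    then have s: "0 < s" "s powr p = (LINT x|M. cmod (f x) powr p)"
      using assms(1) by (auto simp: s_def powr_powr less_le)
    let ?w = "\<lambda>x. cmod (f x) powr p / (p * s powr p) + cmod (g x) powr q / q"
    have "cmod (LINT x|M. f x / s * g x) \<le> (LINT x|M. ?w x)"
    proof (rule order_trans[OF integral_norm_bound integral_mono])
      show "integrable M (\<lambda>x. cmod (f x / s * g x))"
        using Lp_fun_mult_integrable[OF assms(1,2) f assms(3)] by (intro integrable_norm) simp
      show "integrable M ?w"
        using f assms by (auto simp: Lp_fun_def)
      show "cmod (f x / s * g x) \<le> ?w x" for x
        using Youngs_inequality[OF assms(1) q assms(2), of "cmod (f x / s)" "cmod (g x)"] s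
        by (simp add: norm_mult norm_divide powr_divide mult.commute)
    qed
    also have "(LINT x|M. ?w x) = C"
      using f assms s(1) by (simp add: Lp_fun_def C_def flip: s(2))
    finally show ?thesis
      using s by (simp add: norm_divide field_simps)
  qed
qed

lemma Lp_fun_dominated_convergence:
  assumes "1 < p" "\<And>k. Lp_fun M p (F k)" "f \<in> borel_measurable M" "integrable M w"
    "AE x in M. (\<lambda>k. F k x) \<longlonglongrightarrow> f x" "\<And>k. AE x in M. cmod (F k x) powr p \<le> w x"
  shows "Lp_fun M p f"
    "(\<lambda>k. LINT x|M. cmod (F k x) powr p) \<longlonglongrightarrow> (LINT x|M. cmod (f x) powr p)"
proof -
  note [measurable] = assms(3) Lp_fun_measurable[OF assms(2)]
  have lim: "AE x in M. (\<lambda>k. cmod (F k x) powr p) \<longlonglongrightarrow> cmod (f x) powr p"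
    using assms(5) by eventually_elim (use assms(1) in \<open>auto intro!: tendsto_powr' tendsto_norm\<close>)
  have bd: "AE x in M. norm (cmod (F k x) powr p) \<le> w x" for k
    using assms(6)[of k] by simp
  show "Lp_fun M p f"
    unfolding Lp_fun_def
    using integrable_dominated_convergence[OF _ _ assms(4) lim bd] assms(3) by simp
  show "(\<lambda>k. LINT x|M. cmod (F k x) powr p) \<longlonglongrightarrow> (LINT x|M. cmod (f x) powr p)"
    by (rule integral_dominated_convergence[OF _ _ assms(4) lim bd]) simp_all
qed

lemma Lp_fun_fast_Cauchy_limit:
  assumes p: "1 < p" and F: "\<And>k. Lp_fun M p (F k)"
    and fast: "\<And>k. (LINT x|M. cmod (F (Suc k) x - F k x) powr p) \<le> (1 / 2) ^ k * (1 / 2 ^ k) powr p"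
  obtains f w where "f \<in> borel_measurable M" "integrable M w"
    "AE x in M. (\<lambda>k. F k x) \<longlonglongrightarrow> f x" "AE x in M. \<forall>k. cmod (F k x) powr p \<le> w x"
proof -
  note [measurable] = Lp_fun_measurable[OF F]
  \<comment> \<open>Each term of \<open>H\<close> bounds its increment: \<open>|d k| \<le> 2\<^sup>-\<^sup>k H\<^sup>1\<^sup>/\<^sup>p\<close>. So the integrable function \<open>H\<close>
    dominates the whole sequence without Minkowski's inequality.\<close>
  define d where "d k x = F (Suc k) x - F k x" for k x
  define r where "r k x = (2 ^ k) powr p * cmod (d k x) powr p" for k x
  define H where "H x = (\<Sum>k. r k x)" for x
  have r0: "0 \<le> r k x" for k x by (simp add: r_def)
  have r_int: "integrable M (r k)" for k
    unfolding r_def d_def using Lp_fun_integrable[OF Lp_fun_diff[OF p F F]] by simp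
  \<comment> \<open>The rate in \<open>fast\<close> is made for this: its second factor cancels the
    weight \<open>(2 ^ k) powr p\<close>, and its first leaves a convergent geometric
    series.\<close>
  have r_le: "(LINT x|M. r k x) \<le> (1 / 2) ^ k" for k
  proof -
    have "(LINT x|M. r k x) = (2 ^ k) powr p * (LINT x|M. cmod (d k x) powr p)"
      by (simp add: r_def)
    also have "\<dots> \<le> (2 ^ k) powr p * ((1 / 2) ^ k * (1 / 2 ^ k) powr p)"
      using fast[of k] by (intro mult_left_mono) (auto simp: d_def)
    also have "\<dots> = (1 / 2) ^ k"
      by (simp add: powr_divide)
    finally show ?thesis .
  qed
  have r_sum: "summable (\<lambda>k. LINT x|M. norm (r k x))"
    using r_le by (intro summable_comparison_test'[OF summable_geometric[of "1/2::real"]])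
      (auto simp: r0 integral_nonneg)
  \<comment> \<open>The integral of the series of nonnegative terms is the sum of the integrals,
    hence finite, so the series converges almost everywhere.\<close>
  have AE_sum: "AE x in M. summable (\<lambda>k. r k x)"
  proof -
    have [measurable]: "r k \<in> borel_measurable M" for k using r_int by auto
    have "(\<integral>\<^sup>+x. (\<Sum>k. ennreal (r k x)) \<partial>M) = (\<Sum>k. ennreal (LINT x|M. r k x))"
      by (simp add: nn_integral_suminf nn_integral_eq_integral r_int r0)
    also have "\<dots> \<noteq> \<infinity>"
      using r_sum by (simp add: r0 ennreal_suminf_neq_top integral_nonneg)
    finally have "AE x in M. (\<Sum>k. ennreal (r k x)) \<noteq> \<infinity>"
      by (intro nn_integral_noteq_infinite) auto
    then show ?thesis
      by eventually_elim (use r0 in \<open>auto intro: summable_suminf_not_top\<close>)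
  qed
  have H_int: "integrable M H"
    unfolding H_def using AE_sum r_sum r0 by (intro integrable_suminf r_int) auto
  have d_le: "cmod (d k x) \<le> H x powr (1 / p) * (1 / 2) ^ k" if "summable (\<lambda>k. r k x)" for k x
  proof -
    have "r k x \<le> H x"
      unfolding H_def using sum_le_suminf[OF that, of "{k}"] r0 by simp
    then have "r k x powr (1 / p) \<le> H x powr (1 / p)"
      using p r0 by (intro powr_mono2) auto
    also have "r k x powr (1 / p) = 2 ^ k * cmod (d k x)"
      using p by (simp add: r_def powr_mult powr_powr)
    finally show ?thesis by (simp add: field_simps)
  qed
  have F_eq: "F k x = F 0 x + (\<Sum>i<k. d i x)" for k x
    unfolding d_def by (subst sum_lessThan_telescope) simp
  define f where "f x = lim (\<lambda>k. F k x)" for x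
  \<comment> \<open>By the geometric series the partial sums of the \<open>d i x\<close> are at most
    \<open>2 * H x powr (1 / p)\<close>, which gives the inner factor; the outer one comes from
    \<open>cmod_add_powr_le\<close>.\<close>
  define w where "w x = 2 powr p * (cmod (F 0 x) powr p + 2 powr p * H x)" for x
  show ?thesis
  proof (rule that[of f w])
    show "f \<in> borel_measurable M"
      unfolding f_def by measurable
    show "integrable M w"
      unfolding w_def using H_int Lp_fun_integrable[OF F] by simp
    show "AE x in M. (\<lambda>k. F k x) \<longlonglongrightarrow> f x"
      using AE_sum
    proof eventually_elim
      case (elim x)
      have "summable (\<lambda>k. H x powr (1 / p) * (1 / 2) ^ k)"
        by (intro summable_mult summable_geometric) simp
      then have "summable (\<lambda>i. d i x)"
        by (rule summable_comparison_test'[of _ 0]) (use d_le[OF elim] in auto)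
      then have "convergent (\<lambda>k. F 0 x + (\<Sum>i<k. d i x))"
        by (intro convergent_add convergent_const) (simp add: summable_iff_convergent)
      then show ?case
        unfolding f_def F_eq[symmetric] by (simp add: convergent_LIMSEQ_iff)
    qed
    show "AE x in M. \<forall>k. cmod (F k x) powr p \<le> w x"
      using AE_sum
    proof (eventually_elim, intro allI)
      fix x k assume elim: "summable (\<lambda>k. r k x)"
      have H0: "0 \<le> H x" unfolding H_def by (intro suminf_nonneg elim r0)
      have "cmod (\<Sum>i<k. d i x) \<le> (\<Sum>i<k. H x powr (1 / p) * (1 / 2) ^ i)"
        by (intro order_trans[OF norm_sum] sum_mono d_le elim)
      also have "\<dots> = H x powr (1 / p) * (\<Sum>i<k. (1 / 2) ^ i)"
        by (simp add: sum_distrib_left)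
      also have "\<dots> \<le> H x powr (1 / p) * 2"
        by (intro mult_left_mono) (simp_all add: geometric_sum)
      finally have "cmod (\<Sum>i<k. d i x) powr p \<le> (H x powr (1 / p) * 2) powr p"
        using p by (intro powr_mono2) auto
      also have "\<dots> = 2 powr p * H x"
        using p H0 by (simp add: powr_mult powr_powr)
      finally have "2 powr p * (cmod (F 0 x) powr p + cmod (\<Sum>i<k. d i x) powr p) \<le> w x"
        unfolding w_def by (intro mult_left_mono add_left_mono) auto
      then show "cmod (F k x) powr p \<le> w x"
        using cmod_add_powr_le[OF p, of "F 0 x" "\<Sum>i<k. d i x"] F_eq[of k x] by simp
    qed
  qed
qed

subsection \<open>Representation of functionals on subspaces\<close>

text \<open>The midpoint of two near-minimisers lies in \<open>A\<close> and so has p-th power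
  integral at least \<open>d\<close>; hence their convexity defect is small, and the integrated form
  of \<open>cmod_powr_uniformly_convex\<close> makes them close. As \<open>A\<close> is not assumed
  closed, the limit \<open>f\<close> may lie outside it; the approximating \<open>F\<close> and a
  common majorant \<open>w\<close> are returned so that later limits can be taken under the
  integral.\<close>

lemma Lp_minimiser:
  fixes M :: "'a measure"
  assumes p: "1 < p"
    and A: "A \<noteq> {}" "\<And>f. f \<in> A \<Longrightarrow> Lp_fun M p f"
    and mid: "\<And>f g. f \<in> A \<Longrightarrow> g \<in> A \<Longrightarrow> (\<lambda>x. (f x + g x) / 2) \<in> A"
    and d: "\<And>f. f \<in> A \<Longrightarrow> d \<le> (LINT x|M. cmod (f x) powr p)"
    and inf: "\<And>e. 0 < e \<Longrightarrow> \<exists>f\<in>A. (LINT x|M. cmod (f x) powr p) < d + e"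
  obtains f w F where "f \<in> borel_measurable M" "integrable M w" "\<forall>k. F k \<in> A"
    "AE x in M. (\<lambda>k. F k x) \<longlonglongrightarrow> f x" "AE x in M. \<forall>k. cmod (F k x) powr p \<le> w x"
    "(\<lambda>k. LINT x|M. cmod (F k x) powr p) \<longlonglongrightarrow> d"
proof -
  define N where "N f = (LINT x|M. cmod (f x) powr p)" for f
  have close: "\<exists>\<eta>>0. \<forall>f\<in>A. \<forall>g\<in>A. N f < d + \<eta> \<longrightarrow> N g < d + \<eta> \<longrightarrow> N (\<lambda>x. f x - g x) \<le> e"
    if "0 < e" for e
  proof -
    \<comment> \<open>With \<open>\<eta>\<close> at most 1, \<open>d'\<close> bounds both
      \<open>N f\<close> and \<open>N g\<close>. The choice of \<open>e'\<close> then spends e/2 on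
      the first term, and \<open>\<eta>\<close> spends at most e/2 on the term with
      \<open>K\<close>; the \<open>K + 1\<close> in its denominator allows
      \<open>K = 0\<close>.\<close>
    define d' where "d' = max d 0 + 1"
    have d': "1 \<le> d'" "d \<le> d' - 1" by (auto simp: d'_def)
    define e' where "e' = e / (4 * d')"
    have e': "0 < e'" using that d' by (simp add: e'_def)
    obtain K where K: "0 \<le> K" "\<And>a b. cmod (a - b) powr p \<le> e' * (cmod a powr p + cmod b powr p)
        + K * ((cmod a powr p + cmod b powr p) / 2 - cmod ((a + b) / 2) powr p)"
      using cmod_powr_uniformly_convex[OF p e'] by metis
    define \<eta> where "\<eta> = min 1 (e / (2 * (K + 1)))"
    have \<eta>: "0 < \<eta>" "\<eta> \<le> 1" "K * \<eta> \<le> e / 2"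
    proof -
      show "0 < \<eta>" "\<eta> \<le> 1" using that K(1) by (auto simp: \<eta>_def)
      have "K * \<eta> \<le> (K + 1) * (e / (2 * (K + 1)))"
        using K(1) that by (intro mult_mono) (auto simp: \<eta>_def)
      also have "\<dots> = e / 2" using K(1) by (simp add: field_simps)
      finally show "K * \<eta> \<le> e / 2" .
    qed
    have "N (\<lambda>x. f x - g x) \<le> e" if fg: "f \<in> A" "g \<in> A" "N f < d + \<eta>" "N g < d + \<eta>" for f g
    proof -
      note L = A(2)[OF fg(1)] A(2)[OF fg(2)] A(2)[OF mid[OF fg(1,2)]]
      note I = L[THEN Lp_fun_integrable]
      have "N (\<lambda>x. f x - g x) \<le> (LINT x|M. e' * (cmod (f x) powr p + cmod (g x) powr p)
        + K * ((cmod (f x) powr p + cmod (g x) powr p) / 2 - cmod ((f x + g x) / 2) powr p))"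
        unfolding N_def
        by (intro integral_mono Lp_fun_integrable Lp_fun_diff[OF p] L K Bochner_Integration.integrable_add
            Bochner_Integration.integrable_diff integrable_mult_right integrable_divide I)
      also have "\<dots> = e' * (N f + N g) + K * ((N f + N g) / 2 - N (\<lambda>x. (f x + g x) / 2))"
        unfolding N_def using I by simp
      also have "\<dots> \<le> e' * (2 * d') + K * \<eta>"
      proof (intro add_mono mult_left_mono)
        show "N f + N g \<le> 2 * d'" using fg \<eta>(2) d' by linarith
        show "(N f + N g) / 2 - N (\<lambda>x. (f x + g x) / 2) \<le> \<eta>"
          using fg d[OF mid[OF fg(1,2)]] unfolding N_def by (simp add: field_simps)
      qed (use e' K in auto)
      also have "\<dots> \<le> e" using \<eta>(3) d' by (simp add: e'_def field_simps)
      finally show ?thesis .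
    qed
    then show ?thesis using \<eta>(1) by blast
  qed
  define \<epsilon> :: "nat \<Rightarrow> real" where "\<epsilon> k = (1 / 2) ^ k * (1 / 2 ^ k) powr p" for k
  have \<epsilon>: "0 < \<epsilon> k" for k by (simp add: \<epsilon>_def)
  obtain \<eta> where \<eta>: "\<And>k. 0 < \<eta> k"
    "\<And>k f g. f \<in> A \<Longrightarrow> g \<in> A \<Longrightarrow> N f < d + \<eta> k \<Longrightarrow> N g < d + \<eta> k \<Longrightarrow> N (\<lambda>x. f x - g x) \<le> \<epsilon> k"
    using close[OF \<epsilon>] by metis
  \<comment> \<open>The minimum runs over all earlier tolerances because \<open>F (Suc k)\<close>
    must also meet the tolerance \<open>\<eta> k\<close>; the entry \<open>(1 / 2) ^ k\<close>
    drives \<open>N (F k)\<close> to \<open>d\<close>.\<close>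
  define \<mu> where "\<mu> k = Min (insert ((1 / 2) ^ k) (\<eta> ` {..k}))" for k
  have \<mu>: "0 < \<mu> k" "\<mu> k \<le> (1 / 2) ^ k" "j \<le> k \<Longrightarrow> \<mu> k \<le> \<eta> j" for j k
    unfolding \<mu>_def using \<eta>(1) by (auto simp del: Min_insert simp: Min_gr_iff intro: Min_le)
  obtain F where F: "\<And>k. F k \<in> A" "\<And>k. N (F k) < d + \<mu> k"
    using inf[OF \<mu>(1)] unfolding N_def by metis
  have fast: "(LINT x|M. cmod (F (Suc k) x - F k x) powr p) \<le> (1 / 2) ^ k * (1 / 2 ^ k) powr p" for k
  proof -
    have "N (F (Suc k)) < d + \<eta> k" "N (F k) < d + \<eta> k"
      using F(2)[of k] F(2)[of "Suc k"] \<mu>(3)[of k k] \<mu>(3)[of k "Suc k"] by simp_all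
    from \<eta>(2)[OF F(1) F(1) this] show ?thesis by (simp only: N_def \<epsilon>_def)
  qed
  obtain f w where fw: "f \<in> borel_measurable M" "integrable M w"
    "AE x in M. (\<lambda>k. F k x) \<longlonglongrightarrow> f x" "AE x in M. \<forall>k. cmod (F k x) powr p \<le> w x"
    by (rule Lp_fun_fast_Cauchy_limit[OF p A(2)[OF F(1)] fast])
  have "(\<lambda>k. N (F k)) \<longlonglongrightarrow> d"
  proof (rule tendsto_sandwich)
    show "\<forall>\<^sub>F k in sequentially. d \<le> N (F k)"
      using d[OF F(1)] by (simp add: N_def)
    show "\<forall>\<^sub>F k in sequentially. N (F k) \<le> d + (1 / 2) ^ k"
      using F(2) \<mu>(2) by (intro always_eventually allI) (meson add_left_mono less_le_trans less_imp_le)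
    show "(\<lambda>k. d + (1 / 2) ^ k) \<longlonglongrightarrow> d"
      using tendsto_add[OF tendsto_const LIMSEQ_power_zero[of "1 / 2 :: real"], of d] by simp
  qed simp
  then show ?thesis
    using that[OF fw(1,2) _ fw(3,4)] F(1) by (simp add: N_def)
qed

text \<open>\<open>G\<close> is not assumed closed, so the minimiser may lie outside it and \<phi>
  is never evaluated there; everything known about the minimiser is obtained as a limit along
  members of \<open>G\<close>.\<close>

lemma Lp_subspace_functional_representation:
  fixes M :: "'a measure" and \<phi> :: "('a \<Rightarrow> complex) \<Rightarrow> complex"
  assumes p: "1 < p" and q: "1 / p + 1 / q = 1"
    and G: "function_subspace G" "\<And>F. F \<in> G \<Longrightarrow> Lp_fun M p F"
    and add: "\<And>F H. F \<in> G \<Longrightarrow> H \<in> G \<Longrightarrow> \<phi> (\<lambda>x. F x + H x) = \<phi> F + \<phi> H"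
    and cmult: "\<And>c F. F \<in> G \<Longrightarrow> \<phi> (\<lambda>x. c * F x) = c * \<phi> F"
    and bounded: "\<And>F. F \<in> G \<Longrightarrow> cmod (\<phi> F) \<le> C * (LINT x|M. cmod (F x) powr p) powr (1 / p)"
  obtains g where "Lp_fun M q g" "\<And>F. F \<in> G \<Longrightarrow> \<phi> F = (LINT x|M. F x * cnj (g x))"
proof (cases "\<forall>F\<in>G. \<phi> F = 0")
  \<comment> \<open>The zero functional has no elements with value 1, so it is represented
    separately, by 0.\<close>
  case True
  then show ?thesis
    using that[of "\<lambda>_. 0"] by (simp add: Lp_fun_def)
next
  case False
  then obtain F1 where F1: "F1 \<in> G" "\<phi> F1 \<noteq> 0" by blast
  have Gadd: "(\<lambda>x. F x + H x) \<in> G" if "F \<in> G" "H \<in> G" for F H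
    using G(1) that by (simp add: function_subspace_def)
  have Gcmult: "(\<lambda>x. c * F x) \<in> G" if "F \<in> G" for F c
    using G(1) that by (simp add: function_subspace_def)
  have q': "1 < q" "q = p / (p - 1)"
    using conjugate_exponent_gt_1[OF p q] by auto

  \<comment> \<open>The constrained minimisation problem\<close>
  define N where "N f = (LINT x|M. cmod (f x) powr p)" for f
  define A where "A = {F \<in> G. \<phi> F = 1}"
  have A: "A \<noteq> {}" "\<And>f. f \<in> A \<Longrightarrow> f \<in> G" "\<And>f. f \<in> A \<Longrightarrow> \<phi> f = 1"
  proof -
    have "(\<lambda>x. (1 / \<phi> F1) * F1 x) \<in> A"
      using F1 cmult[of F1 "1 / \<phi> F1"] Gcmult[of F1 "1 / \<phi> F1"] by (simp add: A_def)
    then show "A \<noteq> {}" by blast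
  qed (auto simp: A_def)
  have N0: "0 \<le> N f" for f by (simp add: N_def)
  define d where "d = Inf (N ` A)"
  have bdd: "bdd_below (N ` A)" using N0 by (auto simp: bdd_below_def)
  have d_le: "d \<le> N f" if "f \<in> A" for f
    unfolding d_def using bdd that by (intro cInf_lower) auto
  have d_inf: "\<exists>f\<in>A. N f < d + e" if "0 < e" for e
    using cInf_lessD[of "N ` A" "d + e"] A(1) that unfolding d_def by auto
  \<comment> \<open>Boundedness of \<phi> keeps the set where it equals 1 away from the origin:
    \<open>1 \<le> C * N f powr (1 / p)\<close> on \<open>A\<close>. This permits the later division
    by \<open>d\<close>.\<close>
  have d_pos: "0 < d"
  proof -
    have N_ge: "(1 / C) powr p \<le> N f" "0 < C" if "f \<in> A" for f
    proof -
      have 1: "1 \<le> C * N f powr (1 / p)"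
        using bounded[OF A(2)[OF that]] A(3)[OF that] by (simp add: N_def)
      then show "0 < C"
        by (smt (verit) mult_nonneg_nonneg mult_nonpos_nonneg powr_ge_zero)
      then have "1 / C \<le> N f powr (1 / p)" using 1 by (simp add: field_simps)
      then have "(1 / C) powr p \<le> (N f powr (1 / p)) powr p"
        using p \<open>0 < C\<close> by (intro powr_mono2) auto
      then show "(1 / C) powr p \<le> N f" using p N0[of f] by (simp add: powr_powr)
    qed
    then have "0 < C" using A(1) by blast
    then have "0 < (1 / C) powr p" by simp
    also have "\<dots> \<le> d"
      unfolding d_def using A(1) N_ge(1) by (intro cInf_greatest) auto
    finally show ?thesis .
  qed
  have mid: "(\<lambda>x. (f x + g x) / 2) \<in> A" if "f \<in> A" "g \<in> A" for f g
  proof -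
    have "f \<in> G" "g \<in> G" using that A(2) by auto
    then have "(\<lambda>x. (1 / 2) * (f x + g x)) \<in> G" "\<phi> (\<lambda>x. (1 / 2) * (f x + g x)) = 1"
      using that A(3) by (simp_all only: Gcmult Gadd cmult add) simp
    then show ?thesis by (simp add: A_def)
  qed
  obtain f w F where f: "f \<in> borel_measurable M" and w: "integrable M w" and FA: "\<forall>k. F k \<in> A"
    and lim: "AE x in M. (\<lambda>k. F k x) \<longlonglongrightarrow> f x"
    and F_le': "AE x in M. \<forall>k. cmod (F k x) powr p \<le> w x"
    and NF: "(\<lambda>k. N (F k)) \<longlonglongrightarrow> d"
    unfolding N_def
    by (rule Lp_minimiser[OF p A(1) G(2)[OF A(2)] mid d_le[unfolded N_def] d_inf[unfolded N_def]])
  have F: "F k \<in> A" for k using FA by blast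
  have F_le: "AE x in M. cmod (F k x) powr p \<le> w x" for k
    using F_le' by eventually_elim blast
  note Fdc = Lp_fun_dominated_convergence[OF p G(2)[OF A(2)[OF F]] f w lim F_le]
  have fL: "Lp_fun M p f" by (rule Fdc)
  have Nf: "N f = d"
    using LIMSEQ_unique[OF Fdc(2) NF[unfolded N_def]] by (simp add: N_def)

  \<comment> \<open>First variation at the minimiser\<close>
  let ?J = "powr_gradient p"
  have J_L: "Lp_fun M q (\<lambda>x. cnj (?J (h x)))" if "Lp_fun M p h" for h
  proof -
    \<comment> \<open>This identity turns the q-th power of the modulus of the gradient at
      \<open>h x\<close> into \<open>cmod (h x) powr p\<close>.\<close>
    have "(p - 1) * q = p" using p q' by simp
    moreover have "(\<lambda>x. ?J (h x)) \<in> borel_measurable M"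
      using measurable_compose[OF Lp_fun_measurable[OF that] powr_gradient_measurable[OF p]] .
    ultimately show ?thesis
      using that p by (simp add: Lp_fun_def cmod_powr_gradient powr_powr borel_measurable_cnj)
  qed
  have J_int: "integrable M (\<lambda>x. H x * cnj (?J (h x)))" if "Lp_fun M p H" "Lp_fun M p h" for H h
    using Lp_fun_mult_integrable[OF p q that(1) J_L[OF that(2)]] .
  define I where "I H = (LINT x|M. H x * cnj (?J (f x)))" for H
  \<comment> \<open>Adding \<open>t * H\<close> to \<open>F k\<close> stays in \<open>A\<close>, so
    in the limit \<open>N (h t)\<close> is at least \<open>d\<close>, which is \<open>N f\<close>.
    This signs the integral for each positive \<open>t\<close>, and \<open>t\<close> then tends to 0
    through the values \<open>1 / Suc n\<close>.\<close>
  have Re_I: "0 \<le> Re (I H)" if H: "H \<in> G" "\<phi> H = 0" for H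
  proof -
    note HL = G(2)[OF H(1)]
    note [measurable] = Lp_fun_measurable[OF HL] f powr_gradient_measurable[OF p]
    define h where "h t x = f x + complex_of_real t * H x" for t x
    have hL: "Lp_fun M p (h t)" for t
      unfolding h_def by (intro Lp_fun_add[OF p fL] Lp_fun_cmult HL)
    have N_h: "d \<le> N (h t)" for t
    proof (rule LIMSEQ_le_const)
      let ?Ft = "\<lambda>k x. F k x + complex_of_real t * H x"
      have FtA: "?Ft k \<in> A" for k
        using A(2,3)[OF F] H Gadd[of "F k" "\<lambda>x. complex_of_real t * H x"] Gcmult[of H]
          add[of "F k" "\<lambda>x. complex_of_real t * H x"] cmult[of H] by (simp add: A_def)
      show "(\<lambda>k. N (?Ft k)) \<longlonglongrightarrow> N (h t)"
        unfolding N_def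
      proof (rule Lp_fun_dominated_convergence[OF p])
        show "Lp_fun M p (?Ft k)" for k using G(2)[OF A(2)[OF FtA]] .
        show "h t \<in> borel_measurable M" using hL Lp_fun_measurable by blast
        show "integrable M (\<lambda>x. 2 powr p * (w x + cmod (complex_of_real t * H x) powr p))"
          using w Lp_fun_integrable[OF Lp_fun_cmult[OF HL]] by simp
        show "AE x in M. (\<lambda>k. ?Ft k x) \<longlonglongrightarrow> h t x"
          using lim by eventually_elim (auto simp: h_def intro!: tendsto_intros)
        show "AE x in M. cmod (?Ft k x) powr p
            \<le> 2 powr p * (w x + cmod (complex_of_real t * H x) powr p)" for k
          using F_le[of k]
        proof eventually_elim
          case (elim x)
          show ?case
            by (rule order_trans[OF cmod_add_powr_le[OF p]]) (use elim in \<open>intro mult_left_mono add_right_mono; simp\<close>)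
        qed
      qed
      show "\<exists>k0. \<forall>k\<ge>k0. d \<le> N (?Ft k)" using d_le[OF FtA] by blast
    qed
    \<comment> \<open>The tangent inequality is taken at \<open>h t\<close> and evaluated at
      \<open>f\<close>. Together with minimality it gives the sign at once, without difference
      quotients of \<open>N\<close>.\<close>
    have pos: "0 \<le> (LINT x|M. Re (H x * cnj (?J (h t x))))" if t: "0 < t" for t
    proof -
      have int: "integrable M (\<lambda>x. Re (H x * cnj (?J (h t x))))"
        using J_int[OF HL hL] by (rule integrable_Re)
      have "N (h t) - p * t * (LINT x|M. Re (H x * cnj (?J (h t x))))
          = (LINT x|M. cmod (h t x) powr p - p * t * Re (H x * cnj (?J (h t x))))"
        unfolding N_def using int Lp_fun_integrable[OF hL] by simp
      also have "\<dots> \<le> N f"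
        unfolding N_def
      proof (intro integral_mono)
        fix x
        have "Re ((f x - h t x) * cnj (?J (h t x))) = - t * Re (H x * cnj (?J (h t x)))"
          by (simp add: h_def algebra_simps)
        then show "cmod (h t x) powr p - p * t * Re (H x * cnj (?J (h t x))) \<le> cmod (f x) powr p"
          using cmod_powr_ge_tangent[OF p, of "h t x" "f x"] by simp
      qed (use int Lp_fun_integrable[OF hL] Lp_fun_integrable[OF fL] in simp_all)
      finally have "0 \<le> p * t * (LINT x|M. Re (H x * cnj (?J (h t x))))"
        using N_h[of t] Nf by simp
      moreover have "0 < p * t" using p t by simp
      ultimately show ?thesis by (meson not_le mult_pos_neg)
    qed
    \<comment> \<open>The outer \<open>cmod\<close> is redundant; it makes \<open>?u\<close> literally the p-th power of an \<open>L\<^sup>p\<close> function.\<close>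
    let ?u = "\<lambda>x. cmod (complex_of_real (cmod (f x)) + complex_of_real (cmod (H x))) powr p"
    have u: "integrable M ?u"
      using fL HL by (intro Lp_fun_integrable Lp_fun_add[OF p]) (auto simp: Lp_fun_def)
    have "(\<lambda>n. LINT x|M. Re (H x * cnj (?J (h (1 / Suc n) x)))) \<longlonglongrightarrow> (LINT x|M. Re (H x * cnj (?J (f x))))"
    proof (rule integral_dominated_convergence[OF _ _ u])
      show "AE x in M. (\<lambda>n. Re (H x * cnj (?J (h (1 / Suc n) x)))) \<longlonglongrightarrow> Re (H x * cnj (?J (f x)))"
      proof (intro AE_I2)
        fix x
        have "(\<lambda>n. complex_of_real (1 / Suc n)) \<longlonglongrightarrow> complex_of_real 0"
          by (intro tendsto_of_real LIMSEQ_Suc[OF lim_1_over_n])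
        then have "(\<lambda>n. h (1 / Suc n) x) \<longlonglongrightarrow> f x + complex_of_real 0 * H x"
          unfolding h_def by (intro tendsto_add tendsto_mult tendsto_const)
        then have "(\<lambda>n. ?J (h (1 / Suc n) x)) \<longlonglongrightarrow> ?J (f x)"
          by (intro isCont_tendsto_compose[OF isCont_powr_gradient[OF p]]) simp
        then show "(\<lambda>n. Re (H x * cnj (?J (h (1 / Suc n) x)))) \<longlonglongrightarrow> Re (H x * cnj (?J (f x)))"
          by (intro tendsto_Re tendsto_mult tendsto_const) (simp add: lim_cnj)
      qed
      show "AE x in M. norm (Re (H x * cnj (?J (h (1 / Suc n) x)))) \<le> ?u x" for n
      proof (intro AE_I2)
        fix x
        let ?s = "cmod (f x) + cmod (H x)"
        have s: "cmod (complex_of_real (cmod (f x)) + complex_of_real (cmod (H x))) = ?s"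
          by (metis abs_of_nonneg add_nonneg_nonneg norm_ge_zero norm_of_real of_real_add)
        \<comment> \<open>Since \<open>1 / Suc n\<close> is at most 1, the majorant does not depend
          on \<open>n\<close>.\<close>
        have "cmod (h (1 / Suc n) x) \<le> cmod (f x) + (1 / Suc n) * cmod (H x)"
          unfolding h_def by (rule order_trans[OF norm_triangle_ineq]) (simp only: norm_mult norm_of_real, simp)
        also have "\<dots> \<le> ?s"
          using mult_right_mono[of "1 / Suc n" 1 "cmod (H x)"] by simp
        finally have le: "cmod (h (1 / Suc n) x) powr (p - 1) \<le> ?s powr (p - 1)"
          using p by (intro powr_mono2) auto
        have "\<bar>Re (H x * cnj (?J (h (1 / Suc n) x)))\<bar> \<le> cmod (H x) * cmod (h (1 / Suc n) x) powr (p - 1)"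
          using abs_Re_le_cmod[of "H x * cnj (?J (h (1 / Suc n) x))"]
          by (simp add: norm_mult cmod_powr_gradient)
        also have "\<dots> \<le> ?s * ?s powr (p - 1)"
          using le by (intro mult_mono) auto
        also have "\<dots> = ?s powr p"
          by (cases "?s = 0") (simp_all add: powr_diff)
        finally show "norm (Re (H x * cnj (?J (h (1 / Suc n) x)))) \<le> ?u x" by (simp add: s)
      qed
    qed (simp_all add: h_def)
    then have "0 \<le> (LINT x|M. Re (H x * cnj (?J (f x))))"
      by (rule LIMSEQ_le_const) (use pos in auto)
    then show ?thesis
      unfolding I_def using integral_Re[OF J_int[OF HL fL]] by (simp only:)
  qed

  \<comment> \<open>Recovering the functional from its null space\<close>
  have I_cmult: "I (\<lambda>x. c * F x) = c * I F" for c F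
    by (simp add: I_def mult.assoc)
  have I_add: "I (\<lambda>x. F x + H x) = I F + I H" if "F \<in> G" "H \<in> G" for F H
    unfolding I_def using J_int[OF G(2) fL] that by (simp add: distrib_right)
  have I0: "I H = 0" if H: "H \<in> G" "\<phi> H = 0" for H
  proof -
    have re: "0 \<le> Re (c * I H)" for c
      using Re_I[of "\<lambda>x. c * H x"] Gcmult[OF H(1)] cmult[OF H(1)] H(2) I_cmult by simp
    \<comment> \<open>The null space of \<phi> is a complex subspace; rotating \<open>H\<close> by
      the four units yields both signs of the real and of the imaginary part.\<close>
    show ?thesis
      using re[of 1] re[of "-1"] re[of \<i>] re[of "-\<i>"] by (simp add: complex_eq_iff)
  qed
  have I_scale: "I F' = \<phi> F' * I H" if "F' \<in> G" "H \<in> A" for F' H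
  proof -
    \<comment> \<open>Subtracting the right multiple of \<open>H\<close> puts \<open>F'\<close> into
      the null space of \<phi>.\<close>
    let ?D = "\<lambda>x. F' x + (- \<phi> F') * H x"
    have H: "H \<in> G" "\<phi> H = 1" using that A by auto
    have "I ?D = 0"
      by (rule I0) (simp_all only: Gadd Gcmult add cmult that(1) H, simp)
    moreover have "I ?D = I F' + (- \<phi> F') * I H"
      by (simp only: I_add I_cmult Gcmult that(1) H)
    ultimately show ?thesis by simp
  qed
  \<comment> \<open>\<open>I\<close> is constant on \<open>A\<close> by \<open>I_scale\<close>, and
    along the sequence it tends to \<open>I f\<close>, which is the integral of
    \<open>cmod (f x) powr p\<close>.\<close>
  have "I (F k) = d" for k
  proof -
    have "(\<lambda>j. I (F j)) \<longlonglongrightarrow> I f"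
      unfolding I_def
    proof (rule integral_dominated_convergence)
      show "integrable M (\<lambda>x. (w x) / p + cmod (cnj (?J (f x))) powr q / q)"
        using w Lp_fun_integrable[OF J_L[OF fL]] by simp
      show "AE x in M. (\<lambda>j. F j x * cnj (?J (f x))) \<longlonglongrightarrow> f x * cnj (?J (f x))"
        using lim by eventually_elim (auto intro!: tendsto_intros)
      show "AE x in M. norm (F j x * cnj (?J (f x))) \<le> w x / p + cmod (cnj (?J (f x))) powr q / q" for j
        using F_le[of j]
      proof eventually_elim
        case (elim x)
        have "norm (F j x * cnj (?J (f x))) \<le> cmod (F j x) powr p / p + cmod (cnj (?J (f x))) powr q / q"
          unfolding norm_mult by (intro Youngs_inequality p q q') auto
        also have "\<dots> \<le> w x / p + cmod (cnj (?J (f x))) powr q / q"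
          using elim p by (intro add_right_mono divide_right_mono) auto
        finally show ?case .
      qed
      show "(\<lambda>x. f x * cnj (?J (f x))) \<in> borel_measurable M"
        using J_int[OF fL fL] by auto
      show "(\<lambda>x. F j x * cnj (?J (f x))) \<in> borel_measurable M" for j
        using J_int[OF G(2)[OF A(2)[OF F]] fL] by auto
    qed
    moreover have "(\<lambda>j. I (F j)) = (\<lambda>j. I (F k))"
    proof
      show "I (F j) = I (F k)" for j
        using I_scale[OF A(2)[OF F[of j]] F[of k]] A(3)[OF F[of j]] by simp
    qed
    moreover have "I f = d"
      using Nf by (simp add: I_def N_def powr_gradient_mult_cnj[OF p])
    ultimately show ?thesis
      by (simp only: LIMSEQ_const_iff)
  qed
  then have I_eq: "I F' = \<phi> F' * d" if "F' \<in> G" for F'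
    using I_scale[OF that F[of 0]] by simp
  show ?thesis
  proof (rule that[of "\<lambda>x. complex_of_real (1 / d) * ?J (f x)"])
    have "Lp_fun M q (\<lambda>x. ?J (f x))"
      using J_L[OF fL] powr_gradient_measurable[OF p] f by (simp add: Lp_fun_def)
    then show "Lp_fun M q (\<lambda>x. complex_of_real (1 / d) * ?J (f x))"
      by (rule Lp_fun_cmult)
    show "\<phi> F' = (LINT x|M. F' x * cnj (complex_of_real (1 / d) * ?J (f x)))" if "F' \<in> G" for F'
      using I_eq[OF that] d_pos unfolding I_def by (simp add: field_simps)
  qed
qed

subsection \<open>Moving a kernel operator across the pairing\<close>

lemma completion_ex_borel_measurable_complex:
  fixes f :: "'a \<Rightarrow> complex"
  assumes "f \<in> borel_measurable (completion M)"
  shows "\<exists>f'\<in>borel_measurable M. (AE x in M. f' x = f x)"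
proof -
  have re: "(\<lambda>x. Re (f x)) \<in> borel_measurable (completion M)"
    and im: "(\<lambda>x. Im (f x)) \<in> borel_measurable (completion M)"
    using assms by measurable
  from completion_ex_borel_measurable_real[OF re] completion_ex_borel_measurable_real[OF im]
  obtain u v where uv [measurable]: "u \<in> borel_measurable M" "v \<in> borel_measurable M"
    and eq: "AE x in M. Re (f x) = u x" "AE x in M. Im (f x) = v x"
    by blast
  show ?thesis
  proof (rule bexI[of _ "\<lambda>x. Complex (u x) (v x)"])
    show "AE x in M. Complex (u x) (v x) = f x"
      using eq by eventually_elim (simp add: complex_eq_iff)
    show "(\<lambda>x. Complex (u x) (v x)) \<in> borel_measurable M"
      unfolding Complex_eq by measurable
  qed
qed

lemma lebesgue_on_ex_borel_measurable:
  fixes f :: "'a :: euclidean_space \<Rightarrow> complex"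
  assumes "S \<in> sets lebesgue" "f \<in> borel_measurable (lebesgue_on S)"
  obtains f' where "f' \<in> borel_measurable borel" "AE x in lborel. f' x = indicator S x *\<^sub>R f x"
proof -
  have "(\<lambda>x. indicator S x *\<^sub>R f x) \<in> borel_measurable lebesgue"
    using assms by (subst (asm) borel_measurable_restrict_space_iff) auto
  from completion_ex_borel_measurable_complex[OF this]
  obtain f' where "f' \<in> borel_measurable lborel" "AE x in lborel. f' x = indicator S x *\<^sub>R f x"
    by blast
  then show ?thesis using that by simp
qed

text \<open>Restriction to \<open>S\<close> amounts to multiplication by its indicator, almost
  everywhere equal functions share their integral, and completing the measure does not change the
  integral of a Borel function.\<close>

lemma has_bochner_integral_lborel_version:
  fixes f :: "'a :: euclidean_space \<Rightarrow> complex"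
  assumes S: "S \<in> sets lebesgue" and f: "has_bochner_integral (lebesgue_on S) f v"
    and f' [measurable]: "f' \<in> borel_measurable borel"
    and eq: "AE x in lborel. f' x = indicator S x *\<^sub>R f x"
  shows "has_bochner_integral lborel f' v"
proof -
  have int: "integrable lebesgue (\<lambda>x. indicator S x *\<^sub>R f x)"
    and v: "(LINT x|lebesgue. indicator S x *\<^sub>R f x) = v"
    using f integrable_restrict_space[of S lebesgue f] integral_restrict_space[of S lebesgue f] S
    by (simp_all add: has_bochner_integral_iff)
  have eq': "AE x in lebesgue. f' x = indicator S x *\<^sub>R f x"
    using eq by (rule AE_completion)
  have f'_leb: "f' \<in> borel_measurable lebesgue"
    by (rule measurable_completion) simp
  have "integrable lebesgue f'"
    using integrable_cong_AE[OF f'_leb borel_measurable_integrable[OF int] eq'] int by (simp only:)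
  moreover have "(LINT x|lebesgue. f' x) = v"
    using integral_cong_AE[OF f'_leb borel_measurable_integrable[OF int] eq'] v by (simp only:)
  moreover have "f' \<in> borel_measurable lborel" by simp
  ultimately show ?thesis
    by (simp only: has_bochner_integral_iff integrable_completion integral_completion)
qed

lemma AE_lebesgue_on_iff:
  "S \<in> sets lebesgue \<Longrightarrow> (AE x in lebesgue_on S. Q x) \<longleftrightarrow> (AE x in lborel. x \<in> S \<longrightarrow> Q x)"
  using AE_restrict_space_iff[of S lebesgue Q] AE_completion_iff[of "\<lambda>x. x \<in> S \<longrightarrow> Q x" lborel]
  by simp

text \<open>\<open>P\<close> is measurable only for the completed product measure, while Fubini's theorem is stated
  for the product sigma-algebra; the integrands are therefore replaced by Borel versions on the
  whole space, extended by zero outside \<open>\<Omega>\<close>.\<close>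

lemma kernel_adjoint_integral_eq:
  assumes \<Omega>: "\<Omega> \<in> sets lebesgue" "\<Omega> \<times> \<Omega> \<in> sets lebesgue"
    and P: "(\<lambda>(z, w). P z w) \<in> borel_measurable (lebesgue_on (\<Omega> \<times> \<Omega>))"
    and F: "F \<in> borel_measurable (lebesgue_on \<Omega>)" and g: "g \<in> borel_measurable (lebesgue_on \<Omega>)"
    and u: "kernel_maps \<Omega> (abs_kernel P) (\<lambda>w. complex_of_real (cmod (F w))) u"
    and F': "kernel_maps \<Omega> P F F'"
    and h: "kernel_maps \<Omega> (adjoint_kernel P) g h"
    and ug: "integrable (lebesgue_on \<Omega>) (\<lambda>z. u z * complex_of_real (cmod (g z)))"
    and F'g: "integrable (lebesgue_on \<Omega>) (\<lambda>z. F' z * cnj (g z))"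
    and Fh: "integrable (lebesgue_on \<Omega>) (\<lambda>w. F w * cnj (h w))"
  shows "(LINT z|lebesgue_on \<Omega>. F' z * cnj (g z)) = (LINT w|lebesgue_on \<Omega>. F w * cnj (h w))"
proof -
  obtain F1 where [measurable]: "F1 \<in> borel_measurable borel"
    and F1: "AE w in lborel. F1 w = indicator \<Omega> w *\<^sub>R F w"
    using lebesgue_on_ex_borel_measurable[OF \<Omega>(1) F] .
  obtain g1 where [measurable]: "g1 \<in> borel_measurable borel"
    and g1: "AE z in lborel. g1 z = indicator \<Omega> z *\<^sub>R g z"
    using lebesgue_on_ex_borel_measurable[OF \<Omega>(1) g] .
  obtain P1 where P1_borel: "P1 \<in> borel_measurable borel"
    and P1: "AE x in lborel. P1 x = indicator (\<Omega> \<times> \<Omega>) x *\<^sub>R (case x of (z, w) \<Rightarrow> P z w)"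
    using lebesgue_on_ex_borel_measurable[OF \<Omega>(2) P] .
  have P1_meas [measurable]: "P1 \<in> borel_measurable (lborel \<Otimes>\<^sub>M lborel)"
    using P1_borel by (simp add: lborel_prod)
  have P1_pair: "AE x in lborel \<Otimes>\<^sub>M lborel. P1 x = indicator (\<Omega> \<times> \<Omega>) x *\<^sub>R (case x of (z, w) \<Rightarrow> P z w)"
    using P1 unfolding lborel_prod .
  have row: "AE z in lborel. AE w in lborel. P1 (z, w) = indicator \<Omega> z *\<^sub>R indicator \<Omega> w *\<^sub>R P z w"
    using lborel_pair.AE_pair[OF P1_pair] by (simp add: indicator_times)
  \<comment> \<open>\<open>AE_pair\<close> slices a null set along the first coordinate only; the
    columns are reached by swapping the factors, which preserves the product measure.\<close>
  have "AE x in lborel \<Otimes>\<^sub>M lborel. P1 (snd x, fst x) = indicator (\<Omega> \<times> \<Omega>) (snd x, fst x) *\<^sub>R P (snd x) (fst x)"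
  proof -
    have "AE x in distr (lborel \<Otimes>\<^sub>M lborel) (lborel \<Otimes>\<^sub>M lborel) (\<lambda>(x, y). (y, x)).
        P1 x = indicator (\<Omega> \<times> \<Omega>) x *\<^sub>R (case x of (z, w) \<Rightarrow> P z w)"
      using P1_pair by (subst lborel_pair.distr_pair_swap[symmetric])
    from AE_distrD[OF measurable_pair_swap' this] show ?thesis
      by (simp add: case_prod_beta)
  qed
  from lborel_pair.AE_pair[OF this]
  have col: "AE w in lborel. AE z in lborel. P1 (z, w) = indicator \<Omega> z *\<^sub>R indicator \<Omega> w *\<^sub>R P z w"
    by (simp add: indicator_times)
  \<comment> \<open>The common integrand: over \<open>w\<close> it integrates to
    \<open>F' z * cnj (g z)\<close>, over \<open>z\<close> to \<open>F w * cnj (h w)\<close>, both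
    extended by zero outside \<Omega>.\<close>
  define K where "K = (\<lambda>(z, w). P1 (z, w) * F1 w * cnj (g1 z))"
  have K [measurable]: "K \<in> borel_measurable (lborel \<Otimes>\<^sub>M lborel)"
    unfolding K_def by measurable
  have K_row: "AE z in lborel. has_bochner_integral lborel (\<lambda>w. K (z, w)) (indicator \<Omega> z *\<^sub>R (F' z * cnj (g z)))
      \<and> has_bochner_integral lborel (\<lambda>w. complex_of_real (cmod (K (z, w))))
          (indicator \<Omega> z *\<^sub>R (u z * complex_of_real (cmod (g z))))"
    using row g1 F'[unfolded kernel_maps_def AE_lebesgue_on_iff[OF \<Omega>(1)]]
      u[unfolded kernel_maps_def AE_lebesgue_on_iff[OF \<Omega>(1)]]
  proof eventually_elim
    case (elim z)
    show ?case
    proof (cases "z \<in> \<Omega>")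
      case True
      have "has_bochner_integral lborel (\<lambda>w. P1 (z, w) * F1 w) (F' z)"
      proof (rule has_bochner_integral_lborel_version[OF \<Omega>(1)])
        show "has_bochner_integral (lebesgue_on \<Omega>) (\<lambda>w. P z w * F w) (F' z)" using elim True by simp
        show "AE w in lborel. P1 (z, w) * F1 w = indicator \<Omega> w *\<^sub>R (P z w * F w)"
          using elim(1) F1 by eventually_elim (use True in \<open>auto simp: indicator_def\<close>)
      qed measurable
      from has_bochner_integral_mult_left[OF this, of "cnj (g1 z)"]
      have 1: "has_bochner_integral lborel (\<lambda>w. K (z, w)) (F' z * cnj (g1 z))"
        by (simp add: K_def)
      have "has_bochner_integral lborel (\<lambda>w. complex_of_real (cmod (P1 (z, w) * F1 w))) (u z)"
      proof (rule has_bochner_integral_lborel_version[OF \<Omega>(1)])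
        show "has_bochner_integral (lebesgue_on \<Omega>) (\<lambda>w. abs_kernel P z w * complex_of_real (cmod (F w))) (u z)"
          using elim True by simp
        show "AE w in lborel. complex_of_real (cmod (P1 (z, w) * F1 w))
            = indicator \<Omega> w *\<^sub>R (abs_kernel P z w * complex_of_real (cmod (F w)))"
          using elim(1) F1 by eventually_elim (use True in \<open>auto simp: indicator_def norm_mult abs_kernel_def\<close>)
      qed measurable
      from has_bochner_integral_mult_left[OF this, of "complex_of_real (cmod (g1 z))"]
      have 2: "has_bochner_integral lborel (\<lambda>w. complex_of_real (cmod (K (z, w)))) (u z * complex_of_real (cmod (g1 z)))"
        by (simp add: K_def norm_mult)
      show ?thesis using 1 2 elim True by simp
    next
      case False
      then have "K (z, w) = 0" for w using elim by (simp add: K_def)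
      then show ?thesis using False by (simp add: has_bochner_integral_zero)
    qed
  qed
  have K_col: "AE w in lborel. has_bochner_integral lborel (\<lambda>z. K (z, w)) (indicator \<Omega> w *\<^sub>R (F w * cnj (h w)))"
    using col F1 h[unfolded kernel_maps_def AE_lebesgue_on_iff[OF \<Omega>(1)]]
  proof eventually_elim
    case (elim w)
    show ?case
    proof (cases "w \<in> \<Omega>")
      case True
      have "has_bochner_integral lborel (\<lambda>z. cnj (P1 (z, w)) * g1 z) (h w)"
      proof (rule has_bochner_integral_lborel_version[OF \<Omega>(1)])
        show "has_bochner_integral (lebesgue_on \<Omega>) (\<lambda>z. adjoint_kernel P w z * g z) (h w)" using elim True by simp
        show "AE z in lborel. cnj (P1 (z, w)) * g1 z = indicator \<Omega> z *\<^sub>R (adjoint_kernel P w z * g z)"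
          using elim(1) g1 by eventually_elim (use True in \<open>auto simp: indicator_def adjoint_kernel_def\<close>)
      qed measurable
      from has_bochner_integral_mult_left[OF has_bochner_integral_cnj[OF this], of "F1 w"]
      have "has_bochner_integral lborel (\<lambda>z. K (z, w)) (cnj (h w) * F1 w)"
        by (simp add: K_def mult_ac)
      then show ?thesis using elim True by (simp add: mult.commute)
    next
      case False
      then have "K (z, w) = 0" for z using elim by (simp add: K_def)
      then show ?thesis using False by (simp add: has_bochner_integral_zero)
    qed
  qed
  have K_int: "integrable (lborel \<Otimes>\<^sub>M lborel) K"
  proof (rule lborel_pair.Fubini_integrable[OF K])
    \<comment> \<open>The row integrals of \<open>cmod (K (z, w))\<close> are
      \<open>u z * cmod (g z)\<close>, integrable by \<open>ug\<close>; this is the absolute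
      convergence that Fubini needs. The detour through \<open>complex_of_real\<close> and
      \<open>Re\<close> is there because the transfer lemma is complex-valued.\<close>
    have "has_bochner_integral lborel (\<lambda>z. complex_of_real (LINT w|lborel. cmod (K (z, w))))
        (LINT z|lebesgue_on \<Omega>. u z * complex_of_real (cmod (g z)))"
    proof (rule has_bochner_integral_lborel_version[OF \<Omega>(1) has_bochner_integral_integrable[OF ug]])
      show "AE z in lborel. complex_of_real (LINT w|lborel. cmod (K (z, w)))
          = indicator \<Omega> z *\<^sub>R (u z * complex_of_real (cmod (g z)))"
        using K_row by eventually_elim (auto dest: has_bochner_integral_integral_eq)
    qed measurable
    then have "integrable lborel (\<lambda>z. Re (complex_of_real (LINT w|lborel. cmod (K (z, w)))))"
      by (intro integrable_Re) (simp add: has_bochner_integral_iff)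
    then show "integrable lborel (\<lambda>z. LINT w|lborel. norm (K (z, w)))" by simp
    show "AE z in lborel. integrable lborel (\<lambda>w. K (z, w))"
      using K_row by eventually_elim (simp add: has_bochner_integral_iff)
  qed
  have "(LINT z|lborel. LINT w|lborel. K (z, w)) = (LINT z|lebesgue_on \<Omega>. F' z * cnj (g z))"
  proof (intro has_bochner_integral_integral_eq
      has_bochner_integral_lborel_version[OF \<Omega>(1) has_bochner_integral_integrable[OF F'g]])
    show "AE z in lborel. (LINT w|lborel. K (z, w)) = indicator \<Omega> z *\<^sub>R (F' z * cnj (g z))"
      using K_row by eventually_elim (auto dest: has_bochner_integral_integral_eq)
  qed measurable
  moreover have "(LINT w|lborel. LINT z|lborel. K (z, w)) = (LINT w|lebesgue_on \<Omega>. F w * cnj (h w))"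
  proof (intro has_bochner_integral_integral_eq
      has_bochner_integral_lborel_version[OF \<Omega>(1) has_bochner_integral_integrable[OF Fh]])
    show "AE w in lborel. (LINT z|lborel. K (z, w)) = indicator \<Omega> w *\<^sub>R (F w * cnj (h w))"
      using K_col by eventually_elim (auto dest: has_bochner_integral_integral_eq)
  qed measurable
  moreover have "(LINT w|lborel. LINT z|lborel. K (z, w)) = (LINT z|lborel. LINT w|lborel. K (z, w))"
    using lborel_pair.Fubini_integral[of "\<lambda>z w. K (z, w)"] K_int by simp
  ultimately show ?thesis by simp
qed

section \<open>The dual of \<open>G\<close> as the image of the pairing map\<close>

theorem theorem2p15:
  fixes \<Omega> :: "(complex ^ 'n) set"
    and p q :: real
    and P :: "complex ^ 'n \<Rightarrow> complex ^ 'n \<Rightarrow> complex"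
    and G :: "(complex ^ 'n \<Rightarrow> complex) set"
  assumes "open \<Omega>" and "connected \<Omega>" and "\<Omega> \<noteq> {}" and "bounded \<Omega>"
    and "1 < p" and "1 / p + 1 / q = 1"
    and "(\<lambda>(z, w). P z w) \<in> borel_measurable (lebesgue_on (\<Omega> \<times> \<Omega>))"
    and "kernel_bounded \<Omega> 2 P (Lp_space \<Omega> 2) (bergman_space \<Omega> 2)"
    and "function_subspace G" and "G \<subseteq> bergman_space \<Omega> p"
    and "kernel_bounded \<Omega> p (abs_kernel P) (Lp_space \<Omega> p) (Lp_space \<Omega> p)"
    and "\<forall>F\<in>G. kernel_maps \<Omega> P F F"
    and "\<forall>g\<in>Lp_space \<Omega> q. \<exists>h\<in>bergman_space \<Omega> q. kernel_maps \<Omega> (adjoint_kernel P) g h"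
  shows "pairing_map \<Omega> G ` bergman_space \<Omega> q = dual_space \<Omega> p G"
proof -
  let ?L = "lebesgue_on \<Omega>"
  have Lp_space_iff: "f \<in> Lp_space \<Omega> r \<longleftrightarrow> Lp_fun ?L r f" for f r
    by (simp add: Lp_space_def Lp_fun_def)
  have bergman_Lp: "Lp_fun ?L r f" if "f \<in> bergman_space \<Omega> r" for f r
    using that by (simp add: bergman_space_def Lp_space_iff)
  have cnj_Lp: "Lp_fun ?L r (\<lambda>z. cnj (f z))" if "Lp_fun ?L r f" for f r
    using that by (simp add: Lp_fun_def borel_measurable_cnj)
  have abs_Lp: "Lp_fun ?L r (\<lambda>z. complex_of_real (cmod (f z)))" if "Lp_fun ?L r f" for f r
  proof -
    note [measurable] = Lp_fun_measurable[OF that]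
    have "(\<lambda>z. complex_of_real (cmod (f z))) \<in> borel_measurable ?L" by measurable
    then show ?thesis using that by (simp add: Lp_fun_def)
  qed
  note G = bergman_Lp[OF subsetD[OF assms(10)]]
  have G_closed: "\<And>F H. F \<in> G \<Longrightarrow> H \<in> G \<Longrightarrow> (\<lambda>z. F z + H z) \<in> G"
    "\<And>F c. F \<in> G \<Longrightarrow> (\<lambda>z. c * F z) \<in> G"
    using assms(9) by (auto simp: function_subspace_def)
  note pair_int = Lp_fun_mult_integrable[OF assms(5,6)]
  have sets: "\<Omega> \<in> sets lebesgue" "\<Omega> \<times> \<Omega> \<in> sets lebesgue"
    using assms(1) open_Times[OF assms(1) assms(1)] by auto
  show ?thesis
  proof (intro equalityI subsetI)
    \<comment> \<open>This inclusion says that the pairing map is well defined: Hoelder's inequality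
      bounds each pairing functional. The other inclusion is surjectivity.\<close>
    fix \<phi> assume "\<phi> \<in> pairing_map \<Omega> G ` bergman_space \<Omega> q"
    then obtain g where g: "g \<in> bergman_space \<Omega> q" and \<phi>: "\<phi> = pairing_map \<Omega> G g" by blast
    note gL = cnj_Lp[OF bergman_Lp[OF g]]
    have \<phi>_eq: "\<phi> F = (LINT z|?L. F z * cnj (g z))" if "F \<in> G" for F
      using that by (simp add: \<phi> pairing_map_def)
    obtain C where "\<And>F. Lp_fun ?L p F \<Longrightarrow> cmod (LINT z|?L. F z * cnj (g z)) \<le> C * Lp_norm \<Omega> p F"
      using Holder_bound[OF assms(5,6) gL] unfolding Lp_norm_def by blast
    then have "\<exists>C. \<forall>F\<in>G. cmod (\<phi> F) \<le> C * Lp_norm \<Omega> p F"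
      using G \<phi>_eq by auto
    moreover have "\<phi> \<in> extensional G" by (simp add: \<phi> pairing_map_def)
    moreover have "\<phi> (\<lambda>z. F z + H z) = \<phi> F + \<phi> H" if "F \<in> G" "H \<in> G" for F H
      using that G_closed by (simp add: \<phi>_eq distrib_right pair_int[OF G gL])
    moreover have "\<phi> (\<lambda>z. c * F z) = c * \<phi> F" if "F \<in> G" for F c
      using that G_closed by (simp add: \<phi>_eq mult.assoc)
    ultimately show "\<phi> \<in> dual_space \<Omega> p G"
      by (simp add: dual_space_def)
  next
    fix \<phi> assume "\<phi> \<in> dual_space \<Omega> p G"
    then obtain C where \<phi>: "\<phi> \<in> extensional G"
      "\<And>F H. F \<in> G \<Longrightarrow> H \<in> G \<Longrightarrow> \<phi> (\<lambda>z. F z + H z) = \<phi> F + \<phi> H"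
      "\<And>c F. F \<in> G \<Longrightarrow> \<phi> (\<lambda>z. c * F z) = c * \<phi> F"
      "\<And>F. F \<in> G \<Longrightarrow> cmod (\<phi> F) \<le> C * Lp_norm \<Omega> p F"
      unfolding dual_space_def by blast
    obtain g where gL: "Lp_fun ?L q g" and g: "\<And>F. F \<in> G \<Longrightarrow> \<phi> F = (LINT z|?L. F z * cnj (g z))"
      using Lp_subspace_functional_representation[OF assms(5,6,9) G \<phi>(2,3) \<phi>(4)[unfolded Lp_norm_def]] by blast
    obtain h where h: "h \<in> bergman_space \<Omega> q" "kernel_maps \<Omega> (adjoint_kernel P) g h"
      using assms(13) gL Lp_space_iff by blast
    have "\<phi> F = pairing_map \<Omega> G h F" if F: "F \<in> G" for F
    proof -
      \<comment> \<open>\<open>u\<close> represents the image of \<open>cmod (F w)\<close> under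
        |P|; it lies in the p-th Lebesgue space, so its product with the modulus of \<open>g\<close>
        is integrable.\<close>
      obtain u where u: "Lp_fun ?L p u" "kernel_maps \<Omega> (abs_kernel P) (\<lambda>w. complex_of_real (cmod (F w))) u"
        using assms(11)[unfolded kernel_bounded_def] abs_Lp[OF G[OF F], folded Lp_space_iff]
        by (auto simp flip: Lp_space_iff)
      have "\<phi> F = (LINT z|?L. F z * cnj (g z))" using g[OF F] .
      also have "\<dots> = (LINT w|?L. F w * cnj (h w))"
      \<comment> \<open>The reproducing property lets \<open>F\<close> take the place of its own
        image \<open>F'\<close> under the operator.\<close>
      proof (rule kernel_adjoint_integral_eq[OF sets assms(7) _ _ u(2) _ h(2)])
        show "F \<in> borel_measurable ?L" "g \<in> borel_measurable ?L"
          using G[OF F] gL by (simp_all add: Lp_fun_measurable)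
        show "kernel_maps \<Omega> P F F" using assms(12) F by blast
        show "integrable ?L (\<lambda>z. u z * complex_of_real (cmod (g z)))"
          by (rule pair_int[OF u(1) abs_Lp[OF gL]])
        show "integrable ?L (\<lambda>z. F z * cnj (g z))"
          by (rule pair_int[OF G[OF F] cnj_Lp[OF gL]])
        show "integrable ?L (\<lambda>w. F w * cnj (h w))"
          by (rule pair_int[OF G[OF F] cnj_Lp[OF bergman_Lp[OF h(1)]]])
      qed
      finally show ?thesis using F by (simp add: pairing_map_def)
    qed
    then have "\<phi> = pairing_map \<Omega> G h"
      using \<phi>(1) by (intro extensionalityI[of _ G]) (auto simp: pairing_map_def)
    then show "\<phi> \<in> pairing_map \<Omega> G ` bergman_space \<Omega> q"
      using h(1) by blast
  qed
qed

end
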